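(* Let $\gamma,c_1,c_2>0$ be constants and let $\tilde q:\mathbb{R}\to\mathbb{R}$ be a compactly supported $C^2$ function, both independent of $L$. For all sufficiently large $L$ let $\phi=\phi^{(L)}$ be a $2L$-periodic function with $$\phi_x(x)=\gamma L^{c_2-c_1-1}+L^{c_2}\,\tilde q(xL^{c_1}),\qquad x\in(-L,L),$$ where $\phi_x$ has zero mean on $[-L,L]$ and is extended $2L$-periodically. Suppose there is $\delta>0$ independent of $L$ such that, for all sufficiently large $L$, $$\int_{-L}^{L}\left(u_{xx}^2-u_x^2+\phi_x u^2\right)dx\ge\delta\int_{-L}^{L}u^2\,dx$$ for all $2L$-periodic $u\in C^2$ with $u(0)=0$. Then $c_2\ge c_1+1$ and $c_2\le 4c_1$, and consequently $c_2+\frac{c_1}{2}\ge\frac32$ and there is a constant $c>0$ independent of $L$ such that $\|\phi\|_{H^2}\ge\|\phi_{xx}\|_2\ge c\,L^{3/2}$ for all sufficiently large $L$.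
   Context: $\|\cdot\|_2$ and $\|\cdot\|_{H^2}$ denote the $L_2$ and $H^2$ norms on $[-L,L]$. *)

theory Defs
  imports "HOL-Analysis.Analysis" "HOL-Library.Periodic_Fun"
begin

definition C2 :: "(real \<Rightarrow> real) \<Rightarrow> bool" where
  "C2 f \<longleftrightarrow> f C1_differentiable_on UNIV \<and> deriv f C1_differentiable_on UNIV"

definition compactly_supported :: "(real \<Rightarrow> real) \<Rightarrow> bool" where
  "compactly_supported f \<longleftrightarrow> compact (closure (support_on UNIV f))"

definition L2_norm :: "real \<Rightarrow> (real \<Rightarrow> real) \<Rightarrow> real" where
  "L2_norm L f = sqrt (integral {-L..L} (\<lambda>x. (f x)\<^sup>2))"

(* Classical derivatives: agrees with the Sobolev norm when f is C2. *)
definition H2_norm :: "real \<Rightarrow> (real \<Rightarrow> real) \<Rightarrow> real" where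
  "H2_norm L f = sqrt ((L2_norm L f)\<^sup>2 + (L2_norm L (deriv f))\<^sup>2 + (L2_norm L (deriv (deriv f)))\<^sup>2)"

end

theory Submission
  imports Defs
begin

text \<open>
  Write \<open>V\<close> for the potential \<open>\<phi>\<^sub>x\<close>, whose background is \<open>\<gamma> L\<^bsup>c2-c1-1\<^esup>\<close> and whose well
  \<open>L\<^bsup>c2\<^esup> q(x L\<^bsup>c1\<^esup>)\<close> has width of order \<open>L\<^bsup>-c1\<^esup>\<close>. The zero mean of \<open>V\<close> says that
  \<open>q\<close> has integral \<open>-2\<gamma> < 0\<close> (\<open>vanishing_mean_imp_integral\<close>). Both exponent bounds come from
  testing the coercivity inequality with a single function.

  \<^item> The lowest mode \<open>sin (\<pi> x / L)\<close> has nearly vanishing derivatives, and at distance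
    \<open>L\<^bsup>-c1\<^esup>\<close> from the origin it is so small that the well hardly contributes. It sees only
    the background, which must therefore not tend to zero: \<open>c2 \<ge> c1 + 1\<close>
    (\<open>coercive_lowest_mode\<close>, \<open>coercive_imp_exponent_ge\<close>).

  \<^item> A profile \<open>w(x L\<^bsup>c1\<^esup>)\<close> concentrated where \<open>q < 0\<close> has bending energy of order
    \<open>L\<^bsup>3 c1\<^esup>\<close> and gains an energy of order \<open>L\<^bsup>c2-c1\<^esup>\<close> from the well, while the
    background contributes only \<open>L\<^bsup>c2-2c1-1\<^esup>\<close>, which is of lower order. If \<open>c2 > 4 c1\<close>, the gain wins and the
    form becomes negative (\<open>localized_profile\<close>, \<open>coercive_localized\<close>,
    \<open>coercive_imp_exponent_le\<close>).

  The two bounds give \<open>c1 \<ge> 1/3\<close>, hence \<open>c2 + c1/2 \<ge> 1 + 3 c1/2 \<ge> 3/2\<close>. By scaling, the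
  \<open>L\<^sub>2\<close> norm of \<open>\<phi>\<^sub>x\<^sub>x\<close> is, for large \<open>L\<close>, exactly \<open>L\<^bsup>c2+c1/2\<^esup>\<close> times that of \<open>q'\<close>
  (\<open>L2_norm_second_deriv\<close>), and \<open>q'\<close> does not vanish identically because \<open>q\<close> has compact
  support and nonzero integral.
\<close>

section \<open>Twice continuously differentiable functions\<close>

lemma C2_I:
  assumes u: "\<And>x. (u has_real_derivative u' x) (at x)"
    and u': "\<And>x. (u' has_real_derivative u'' x) (at x)"
    and u'': "continuous_on UNIV u''"
  shows "C2 u" "deriv u = u'" "deriv (deriv u) = u''"
proof -
  show d: "deriv u = u'" using u by (auto intro: DERIV_imp_deriv)
  show "deriv (deriv u) = u''" unfolding d using u' by (auto intro: DERIV_imp_deriv)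
  have "continuous_on UNIV u'"
    using u' by (meson DERIV_isCont continuous_at_imp_continuous_on)
  then show "C2 u"
    unfolding C2_def C1_differentiable_on_def d
    using u u' u'' by (auto simp: has_real_derivative_iff_has_vector_derivative)
qed

lemma C2_D:
  assumes "C2 f"
  shows "(f has_real_derivative deriv f x) (at x)"
    and "(deriv f has_real_derivative deriv (deriv f) x) (at x)"
    and "continuous_on UNIV (deriv (deriv f))"
proof -
  obtain D where D: "\<And>x. (f has_vector_derivative D x) (at x)"
    using assms unfolding C2_def C1_differentiable_on_def by auto
  obtain E where E: "\<And>x. (deriv f has_vector_derivative E x) (at x)" "continuous_on UNIV E"
    using assms unfolding C2_def C1_differentiable_on_def by auto
  show "(f has_real_derivative deriv f x) (at x)"
    using D DERIV_imp_deriv has_real_derivative_iff_has_vector_derivative by metis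
  have *: "(deriv f has_real_derivative E x) (at x)" for x
    using E(1) by (simp add: has_real_derivative_iff_has_vector_derivative)
  then have "deriv (deriv f) = E" by (auto intro: DERIV_imp_deriv)
  then show "(deriv f has_real_derivative deriv (deriv f) x) (at x)"
    and "continuous_on UNIV (deriv (deriv f))"
    using * E(2) by auto
qed

lemma DERIV_max_0_power:
  fixes x :: real
  shows "((\<lambda>x. max 0 x ^ (n + 2)) has_real_derivative real (n + 2) * max 0 x ^ (n + 1)) (at x)"
proof -
  consider "x > 0" | "x < 0" | "x = 0" by linarith
  then show ?thesis
  proof cases
    case 1
    have ev: "\<forall>\<^sub>F y in nhds x. max 0 y ^ (n + 2) = y ^ (n + 2)"
      using eventually_nhds_in_open[of "{0<..}" x] 1
      by (auto elim!: eventually_mono simp: max_def)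
    have "((\<lambda>x. x ^ (n + 2)) has_real_derivative real (n + 2) * max 0 x ^ (n + 1)) (at x)"
      using 1 DERIV_pow[of "n + 2" x] by (simp add: max_def)
    then show ?thesis using DERIV_cong_ev[OF refl ev refl] by blast
  next
    case 2
    have ev: "\<forall>\<^sub>F y in nhds x. max 0 y ^ (n + 2) = 0"
      using eventually_nhds_in_open[of "{..<0}" x] 2
      by (auto elim!: eventually_mono simp: max_def)
    have "((\<lambda>x. 0) has_real_derivative real (n + 2) * max 0 x ^ (n + 1)) (at x)"
      using 2 by (auto simp: max_def)
    then show ?thesis using DERIV_cong_ev[OF refl ev refl] by blast
  next
    case 3
    have "((\<lambda>h. max 0 h ^ (n + 2) / h) \<longlongrightarrow> 0) (at (0::real))"
    proof (rule Lim_null_comparison)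
      show "\<forall>\<^sub>F h in at 0. norm (max 0 h ^ (n + 2) / h) \<le> \<bar>h\<bar> ^ (n + 1)"
        by (auto simp: max_def eventually_at_filter intro!: always_eventually mult_nonpos_nonneg)
      show "((\<lambda>h::real. \<bar>h\<bar> ^ (n + 1)) \<longlongrightarrow> 0) (at 0)"
        by (auto intro!: tendsto_eq_intros)
    qed
    then show ?thesis using 3 by (simp add: DERIV_def)
  qed
qed

section \<open>Periodic continuation of compactly supported functions\<close>

text \<open>The representative of \<open>x\<close> modulo \<open>2L\<close> in \<open>[-L, L)\<close>. Composing a function on
  \<open>[-L, L]\<close> with it yields the \<open>2L\<close>-periodic continuation.\<close>
definition wrap :: "real \<Rightarrow> real \<Rightarrow> real" where
  "wrap L x = x - 2 * L * of_int \<lfloor>(x + L) / (2 * L)\<rfloor>"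

lemma wrap_periodic: "L > 0 \<Longrightarrow> wrap L (x + 2 * L) = wrap L x"
proof -
  assume "L > 0"
  then have "(x + 2 * L + L) / (2 * L) = (x + L) / (2 * L) + 1" by (simp add: field_simps)
  then have "\<lfloor>(x + 2 * L + L) / (2 * L)\<rfloor> = \<lfloor>(x + L) / (2 * L)\<rfloor> + 1" by linarith
  then show ?thesis by (simp add: wrap_def algebra_simps)
qed

lemma wrap_range: "L > 0 \<Longrightarrow> - L \<le> wrap L x \<and> wrap L x < L"
proof -
  assume L: "L > 0"
  have "of_int \<lfloor>(x + L) / (2 * L)\<rfloor> \<le> (x + L) / (2 * L)"
    "(x + L) / (2 * L) < of_int \<lfloor>(x + L) / (2 * L)\<rfloor> + 1" by linarith+
  then have "of_int \<lfloor>(x + L) / (2 * L)\<rfloor> * (2 * L) \<le> x + L"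
    "x + L < (of_int \<lfloor>(x + L) / (2 * L)\<rfloor> + 1) * (2 * L)"
    using L by (simp_all only: pos_le_divide_eq pos_divide_less_eq mult_pos_pos zero_less_numeral)
  then show ?thesis by (simp add: wrap_def algebra_simps)
qed

text \<open>Although \<open>wrap\<close> jumps at the odd multiples of \<open>L\<close>, the continuation of a function
  supported in \<open>[-r, r]\<close> with \<open>r < L\<close> is locally a translate of it: if \<open>x\<close> and \<open>y\<close> lie in
  different periods and are closer than \<open>L - r\<close>, both sides are zero. Smoothness then carries over
  from the function to its continuation.\<close>
lemma periodize_eq_translate:
  assumes L: "L > 0" and r: "r < L" and g: "\<And>x. \<bar>x\<bar> \<ge> r \<Longrightarrow> g x = (0::real)"
    and xy: "\<bar>y - x\<bar> < L - r"
  shows "g (wrap L y) = g (y - (x - wrap L x))"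
proof -
  define n m where "n = \<lfloor>(x + L) / (2 * L)\<rfloor>" and "m = \<lfloor>(y + L) / (2 * L)\<rfloor>"
  have wx: "wrap L x = x - 2 * L * of_int n" and wy: "wrap L y = y - 2 * L * of_int m"
    by (simp_all add: wrap_def n_def m_def)
  have rx: "- L \<le> x - 2 * L * of_int n" "x - 2 * L * of_int n < L"
    and ry: "- L \<le> y - 2 * L * of_int m" "y - 2 * L * of_int m < L"
    using wrap_range[OF L] wx wy by metis+
  \<comment> \<open>When the periods differ, both arguments of \<open>g\<close> have absolute value at least \<open>r\<close>.\<close>
  consider "m = n" | "n + 1 \<le> m" | "m + 1 \<le> n" by linarith
  then show ?thesis
  proof cases
    case 1 then show ?thesis by (simp add: wx wy)
  next
    case 2
    then have "2 * L * (real_of_int n + 1) \<le> 2 * L * of_int m"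
      using L by (intro mult_left_mono) auto
    then have "\<bar>wrap L y\<bar> \<ge> r" "\<bar>y - (x - wrap L x)\<bar> \<ge> r"
      using rx ry xy r L unfolding wx wy by (auto simp: algebra_simps)
    then show ?thesis using g by simp
  next
    case 3
    then have "2 * L * (real_of_int m + 1) \<le> 2 * L * of_int n"
      using L by (intro mult_left_mono) auto
    then have "\<bar>wrap L y\<bar> \<ge> r" "\<bar>y - (x - wrap L x)\<bar> \<ge> r"
      using rx ry xy r L unfolding wx wy by (auto simp: algebra_simps)
    then show ?thesis using g by simp
  qed
qed

lemma eventually_periodize_eq_translate:
  assumes "L > 0" and "r < L" and "\<And>x. \<bar>x\<bar> \<ge> r \<Longrightarrow> g x = (0::real)"
  shows "\<forall>\<^sub>F y in nhds x. g (wrap L y) = g (y - (x - wrap L x))"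
proof -
  have "\<forall>\<^sub>F y in nhds x. dist y x < L - r"
    unfolding eventually_nhds_metric using assms(2) by (intro exI[of _ "L - r"]) auto
  then show ?thesis
    by eventually_elim (use periodize_eq_translate[OF assms] in \<open>auto simp: dist_real_def\<close>)
qed

lemma periodize_eq:
  assumes "L > 0" and "r < L" and "\<And>x. \<bar>x\<bar> \<ge> r \<Longrightarrow> g x = (0::real)" and x: "\<bar>x\<bar> \<le> L"
  shows "g (wrap L x) = g x"
proof -
  have w0: "wrap L 0 = 0" using assms(1) by (simp add: wrap_def)
  show ?thesis
  proof (cases "\<bar>x\<bar> < L")
    case True
    then have "\<lfloor>(x + L) / (2 * L)\<rfloor> = 0" using assms(1) by (simp add: floor_eq_iff)
    then show ?thesis by (simp add: wrap_def)
  next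
    case False
    then have "x = L \<or> x = - L" using x by auto
    moreover have "wrap L L = - L" "wrap L (- L) = - L"
      using assms(1) by (simp_all add: wrap_def)
    moreover have "g L = 0" "g (- L) = 0" using assms(1,2) by (auto intro: assms(3))
    ultimately show ?thesis by auto
  qed
qed

lemma DERIV_periodize:
  assumes L: "L > 0" "r < L" "\<And>x. \<bar>x\<bar> \<ge> r \<Longrightarrow> g x = (0::real)"
    and g: "\<And>x. (g has_real_derivative g' x) (at x)"
  shows "((\<lambda>x. g (wrap L x)) has_real_derivative g' (wrap L x)) (at x)"
proof -
  have "((\<lambda>y. g (y - (x - wrap L x))) has_real_derivative g' (wrap L x)) (at x)"
  proof -
    have "((\<lambda>y. y - (x - wrap L x)) has_real_derivative 1) (at x)"
      by (auto intro!: derivative_eq_intros)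
    from DERIV_chain2[OF g this] show ?thesis by simp
  qed
  then show ?thesis
    using DERIV_cong_ev[OF refl eventually_periodize_eq_translate[where g = g, OF L] refl] by blast
qed

lemma continuous_periodize:
  assumes L: "L > 0" "r < L" "\<And>x. \<bar>x\<bar> \<ge> r \<Longrightarrow> g x = (0::real)"
    and g: "continuous_on UNIV g"
  shows "continuous_on UNIV (\<lambda>x. g (wrap L x))"
proof (rule continuous_at_imp_continuous_on, rule ballI)
  fix x
  have "continuous_on UNIV (\<lambda>y. g (y - (x - wrap L x)))"
    by (rule continuous_on_compose2[OF g]) (auto intro!: continuous_intros)
  then have "isCont (\<lambda>y. g (y - (x - wrap L x))) x"
    by (simp add: continuous_on_eq_continuous_at)
  then show "isCont (\<lambda>x. g (wrap L x)) x"
    using isCont_cong[OF eventually_periodize_eq_translate[where g = g, OF L]] by blast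
qed

section \<open>The coercivity inequality and two trial functions\<close>

lemma has_integral_rescaled:
  assumes g: "continuous_on UNIV g" "\<And>x. \<bar>x\<bar> \<ge> R \<Longrightarrow> g x = (0::real)"
    and s: "s > 0" "R \<le> L * s"
  shows "((\<lambda>x. g (x * s)) has_integral integral {-R..R} g / s) {-L..L}"
proof -
  have "(g has_integral integral {-R..R} g) {-R..R}"
    using g(1) by (intro integrable_integral integrable_continuous_real)
      (auto intro: continuous_on_subset)
  then have "(g has_integral integral {-R..R} g) {-(L * s)..L * s}"
    by (rule has_integral_on_superset) (use g(2) s in auto)
  then have "(g has_integral integral {-R..R} g) (cbox (-(L * s)) (L * s))" by simp
  from has_integral_affinity'[OF this s(1), of 0]
  show ?thesis using s(1) by (simp add: field_simps)
qed

text \<open>The spectral inequality for trial functions given together with their first two derivatives, so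
  that no \<open>deriv\<close> has to be evaluated when a trial function is inserted.\<close>
definition coercive_potential :: "real \<Rightarrow> (real \<Rightarrow> real) \<Rightarrow> real \<Rightarrow> bool" where
  "coercive_potential L V \<delta> \<longleftrightarrow> (\<forall>u u' u''.
     (\<forall>x. (u has_real_derivative u' x) (at x)) \<longrightarrow>
     (\<forall>x. (u' has_real_derivative u'' x) (at x)) \<longrightarrow> continuous_on UNIV u'' \<longrightarrow>
     (\<forall>x. u (x + 2 * L) = u x) \<longrightarrow> u 0 = 0 \<longrightarrow>
     \<delta> * integral {-L..L} (\<lambda>x. (u x)\<^sup>2)
       \<le> integral {-L..L} (\<lambda>x. (u'' x)\<^sup>2 - (u' x)\<^sup>2 + V x * (u x)\<^sup>2))"

text \<open>The explicit formula for the potential holds on the open interval only; the endpoints do not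
  affect the integral.\<close>
lemma coercive_potentialI:
  assumes W: "\<And>x. x \<in> {-L<..<L} \<Longrightarrow> W x = V x"
    and co: "\<And>u :: real \<Rightarrow> real. C2 u \<Longrightarrow> periodic_fun_simple u (2 * L) \<Longrightarrow> u 0 = 0 \<Longrightarrow>
      \<delta> * integral {-L..L} (\<lambda>x. (u x)\<^sup>2)
        \<le> integral {-L..L} (\<lambda>x. (deriv (deriv u) x)\<^sup>2 - (deriv u x)\<^sup>2 + W x * (u x)\<^sup>2)"
  shows "coercive_potential L V \<delta>"
  unfolding coercive_potential_def
proof (intro allI impI)
  fix u u' u'' :: "real \<Rightarrow> real"
  assume u: "\<forall>x. (u has_real_derivative u' x) (at x)"
    "\<forall>x. (u' has_real_derivative u'' x) (at x)" "continuous_on UNIV u''"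
    and per: "\<forall>x. u (x + 2 * L) = u x" and u0: "u 0 = 0"
  note d = C2_I[of u u' u'', OF u(1)[rule_format] u(2)[rule_format] u(3)]
  have "\<delta> * integral {-L..L} (\<lambda>x. (u x)\<^sup>2)
      \<le> integral {-L..L} (\<lambda>x. (u'' x)\<^sup>2 - (u' x)\<^sup>2 + W x * (u x)\<^sup>2)"
    using co[OF d(1) _ u0] per unfolding d(3) unfolding d(2) by (simp add: periodic_fun_simple_def)
  also have "\<dots> = integral {-L..L} (\<lambda>x. (u'' x)\<^sup>2 - (u' x)\<^sup>2 + V x * (u x)\<^sup>2)"
    by (rule integral_spike[of "{-L, L}"]) (auto simp: W)
  finally show "\<delta> * integral {-L..L} (\<lambda>x. (u x)\<^sup>2)
      \<le> integral {-L..L} (\<lambda>x. (u'' x)\<^sup>2 - (u' x)\<^sup>2 + V x * (u x)\<^sup>2)" .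
qed

text \<open>The trial function is \<open>sin (k x)\<close> with \<open>k = \<pi> / L\<close>. On the support of the well its modulus
  is at most \<open>k R / s\<close>, so the integrand is bounded pointwise by a constant; comparing integrals over
  \<open>[-L, L]\<close> with \<open>\<integral> sin\<^sup>2 (k x) dx = L\<close> leaves the factor 2.\<close>
lemma coercive_lowest_mode:
  assumes co: "coercive_potential L (\<lambda>x. A + B * q (x * s)) \<delta>"
    and q: "continuous_on UNIV q" "\<And>x. \<bar>x\<bar> \<ge> R \<Longrightarrow> q x = 0" "\<And>x. \<bar>q x\<bar> \<le> M"
    and pos: "A \<ge> 0" "B \<ge> 0" "s > 0" "L > 0" "R > 0"
  shows "\<delta> \<le> 2 * ((pi / L) ^ 4 + A + B * (M * (pi / L * (R / s))\<^sup>2))"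
proof -
  define k where "k = pi / L"
  have k: "k > 0" and kL: "k * L = pi" using pos by (auto simp: k_def)
  define E where "E = k ^ 4 + A + B * (M * (k * (R / s))\<^sup>2)"
  let ?F = "\<lambda>x. (- k\<^sup>2 * sin (k * x))\<^sup>2 - (k * cos (k * x))\<^sup>2 + (A + B * q (x * s)) * (sin (k * x))\<^sup>2"
  have M: "M \<ge> 0" using q(3)[of 0] by linarith
  have "\<delta> * integral {-L..L} (\<lambda>x. (sin (k * x))\<^sup>2) \<le> integral {-L..L} ?F"
  proof (rule co[unfolded coercive_potential_def, rule_format])
    show "((\<lambda>x. sin (k * x)) has_real_derivative k * cos (k * x)) (at x)" for x
      by (auto intro!: derivative_eq_intros)
    show "((\<lambda>x. k * cos (k * x)) has_real_derivative - k\<^sup>2 * sin (k * x)) (at x)" for x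
      by (auto intro!: derivative_eq_intros simp: power2_eq_square)
    show "continuous_on UNIV (\<lambda>x. - k\<^sup>2 * sin (k * x))" by (intro continuous_intros)
    have "k * (x + 2 * L) = k * x + 2 * pi" for x using kL by (simp add: algebra_simps)
    then show "sin (k * (x + 2 * L)) = sin (k * x)" for x by simp
  qed simp
  also have "integral {-L..L} ?F \<le> integral {-L..L} (\<lambda>x. E)"
  proof (rule integral_le)
    have "continuous_on UNIV (\<lambda>x. q (x * s))"
      by (rule continuous_on_compose2[OF q(1)]) (auto intro!: continuous_intros)
    then show "?F integrable_on {-L..L}"
      by (intro integrable_continuous_real continuous_intros) (auto intro: continuous_on_subset)
    show "(\<lambda>x. E) integrable_on {-L..L}" by (rule integrable_const_ivl)
    fix x
    have s1: "(sin (k * x))\<^sup>2 \<le> 1" by (simp add: abs_square_le_1)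
    have 1: "(- k\<^sup>2 * sin (k * x))\<^sup>2 \<le> k ^ 4"
    proof -
      have "(- k\<^sup>2 * sin (k * x))\<^sup>2 = k ^ 4 * (sin (k * x))\<^sup>2"
        by (simp add: power_mult_distrib flip: power_mult)
      then show ?thesis using mult_left_mono[OF s1, of "k ^ 4"] by simp
    qed
    have 2: "q (x * s) * (sin (k * x))\<^sup>2 \<le> M * (k * (R / s))\<^sup>2"
    proof (cases "\<bar>x * s\<bar> \<ge> R")
      case True
      then show ?thesis using q(2) M by simp
    next
      case False
      have "\<bar>sin (k * x)\<bar> \<le> \<bar>k * x\<bar>" by (rule abs_sin_x_le_abs_x)
      also have "\<dots> \<le> k * (R / s)"
        using False k pos by (simp add: abs_mult field_simps)
      finally have "(sin (k * x))\<^sup>2 \<le> (k * (R / s))\<^sup>2"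
        using k pos by (simp add: abs_le_square_iff[symmetric])
      moreover have "q (x * s) \<le> M" using q(3)[of "x * s"] by linarith
      ultimately show ?thesis using M by (intro mult_mono) auto
    qed
    have "A * (sin (k * x))\<^sup>2 \<le> A" using mult_left_mono[OF s1 pos(1)] by simp
    moreover have "B * (q (x * s) * (sin (k * x))\<^sup>2) \<le> B * (M * (k * (R / s))\<^sup>2)"
      by (rule mult_left_mono[OF 2 pos(2)])
    moreover have "(A + B * q (x * s)) * (sin (k * x))\<^sup>2
        = A * (sin (k * x))\<^sup>2 + B * (q (x * s) * (sin (k * x))\<^sup>2)"
      by (simp add: algebra_simps)
    ultimately show "?F x \<le> E"
      unfolding E_def using 1 zero_le_power2[of "k * cos (k * x)"] by linarith
  qed
  also have "\<dots> = 2 * L * E" using pos by simp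
  finally have le: "\<delta> * integral {-L..L} (\<lambda>x. (sin (k * x))\<^sup>2) \<le> 2 * L * E" .
  have "((\<lambda>x. (sin (k * x))\<^sup>2) has_integral
      (L / 2 - sin (k * L) * cos (k * L) / (2 * k)) - (- L / 2 - sin (k * (- L)) * cos (k * (- L)) / (2 * k))) {-L..L}"
  proof (rule fundamental_theorem_of_calculus)
    fix x
    have "((\<lambda>x. x / 2 - sin (k * x) * cos (k * x) / (2 * k)) has_real_derivative
        1 / 2 - (cos (k * x) * k * cos (k * x) - sin (k * x) * (sin (k * x) * k)) / (2 * k)) (at x)"
      using k by (auto intro!: derivative_eq_intros simp: field_simps)
    moreover have "1 / 2 - (cos (k * x) * k * cos (k * x) - sin (k * x) * (sin (k * x) * k)) / (2 * k)
        = (sin (k * x))\<^sup>2"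
    proof -
      have "(cos (k * x) * k * cos (k * x) - sin (k * x) * (sin (k * x) * k)) / (2 * k)
          = ((cos (k * x))\<^sup>2 - (sin (k * x))\<^sup>2) / 2"
        using k by (simp add: field_simps power2_eq_square)
      then show ?thesis by (simp add: cos_squared_eq field_simps)
    qed
    ultimately show "((\<lambda>x. x / 2 - sin (k * x) * cos (k * x) / (2 * k)) has_vector_derivative
        (sin (k * x))\<^sup>2) (at x within {-L..L})"
      by (metis has_real_derivative_iff_has_vector_derivative has_field_derivative_at_within)
  qed (use pos in auto)
  then have "integral {-L..L} (\<lambda>x. (sin (k * x))\<^sup>2) = L"
    by (simp add: kL integral_unique)
  then have "L * \<delta> \<le> L * (2 * E)" using le by (simp add: algebra_simps)
  then have "\<delta> \<le> 2 * E" using pos(4) by (simp only: mult_le_cancel_left_pos)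
  then show ?thesis by (simp add: E_def k_def)
qed

text \<open>The trial function is the periodic continuation of \<open>w(x s)\<close>. Substituting \<open>y = x s\<close> gives
  every term the common factor \<open>1 / s\<close>, which drops out; the term with the
  first derivative only lowers the energy and is discarded.\<close>
lemma coercive_localized:
  assumes co: "coercive_potential L (\<lambda>x. A + B * q (x * s)) \<delta>" and "\<delta> \<ge> 0"
    and q: "continuous_on UNIV q"
    and w: "\<And>x. (w has_real_derivative w' x) (at x)" "\<And>x. (w' has_real_derivative w'' x) (at x)"
      "continuous_on UNIV w''" "w 0 = 0"
    and supp: "\<And>x. \<bar>x\<bar> \<ge> R \<Longrightarrow> w x = 0" "\<And>x. \<bar>x\<bar> \<ge> R \<Longrightarrow> w' x = 0" "\<And>x. \<bar>x\<bar> \<ge> R \<Longrightarrow> w'' x = 0"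
    and pos: "s > 0" "L > 0" "R < L * s"
  shows "0 \<le> s ^ 4 * integral {-R..R} (\<lambda>x. (w'' x)\<^sup>2) + A * integral {-R..R} (\<lambda>x. (w x)\<^sup>2)
    + B * integral {-R..R} (\<lambda>x. q x * (w x)\<^sup>2)"
proof -
  define u u' u'' where "u = (\<lambda>x. w (x * s))" and "u' = (\<lambda>x. s * w' (x * s))"
    and "u'' = (\<lambda>x. s\<^sup>2 * w'' (x * s))"
  have r: "R / s < L" using pos by (simp add: field_simps)
  have "R \<le> \<bar>x * s\<bar>" if "R / s \<le> \<bar>x\<bar>" for x
    using that pos by (simp add: field_simps abs_mult)
  then have supp': "\<And>x. \<bar>x\<bar> \<ge> R / s \<Longrightarrow> u x = 0" "\<And>x. \<bar>x\<bar> \<ge> R / s \<Longrightarrow> u' x = 0"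
    "\<And>x. \<bar>x\<bar> \<ge> R / s \<Longrightarrow> u'' x = 0"
    by (simp_all add: u_def u'_def u''_def supp)
  have cw: "continuous_on UNIV w" "continuous_on UNIV w'"
    using w(1,2) by (meson DERIV_isCont continuous_at_imp_continuous_on)+
  have scale: "((\<lambda>x. x * s) has_real_derivative s) (at x)" for x
    by (auto intro!: derivative_eq_intros)
  have d1: "(u has_real_derivative u' x) (at x)" for x
    using DERIV_chain2[OF w(1) scale] unfolding u_def u'_def by (metis mult.commute)
  have d2: "(u' has_real_derivative u'' x) (at x)" for x
    unfolding u'_def u''_def
    by (rule DERIV_cong[OF DERIV_cmult[OF DERIV_chain2[OF w(2) scale]]]) (simp add: power2_eq_square)
  have c2: "continuous_on UNIV u''" unfolding u''_def
    by (intro continuous_intros continuous_on_compose2[OF w(3)]) auto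
  have cu: "continuous_on UNIV u"
    using d1 by (meson DERIV_isCont continuous_at_imp_continuous_on)
  let ?P = "wrap L"
  let ?V = "\<lambda>x. A + B * q (x * s)"
  let ?G = "\<lambda>y. (s\<^sup>2 * w'' y)\<^sup>2 - (s * w' y)\<^sup>2 + (A + B * q y) * (w y)\<^sup>2"
  have "0 \<le> \<delta> * integral {-L..L} (\<lambda>x. (u (?P x))\<^sup>2)"
    using \<open>\<delta> \<ge> 0\<close> continuous_on_subset[OF continuous_periodize[OF pos(2) r supp'(1) cu]]
    by (intro mult_nonneg_nonneg integral_nonneg integrable_continuous_real continuous_intros) auto
  also have "\<dots> \<le> integral {-L..L} (\<lambda>x. (u'' (?P x))\<^sup>2 - (u' (?P x))\<^sup>2 + ?V x * (u (?P x))\<^sup>2)"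
  proof (rule co[unfolded coercive_potential_def, rule_format])
    show "((\<lambda>x. u (?P x)) has_real_derivative u' (?P x)) (at x)" for x
      by (rule DERIV_periodize[OF pos(2) r supp'(1) d1])
    show "((\<lambda>x. u' (?P x)) has_real_derivative u'' (?P x)) (at x)" for x
      by (rule DERIV_periodize[OF pos(2) r supp'(2) d2])
    show "continuous_on UNIV (\<lambda>x. u'' (?P x))"
      by (rule continuous_periodize[OF pos(2) r supp'(3) c2])
    show "u (?P (x + 2 * L)) = u (?P x)" for x by (simp add: wrap_periodic[OF pos(2)])
    show "u (?P 0) = 0" using pos(2) w(4) by (simp add: wrap_def u_def)
  qed
  also have "\<dots> = integral {-L..L} (\<lambda>x. ?G (x * s))"
  proof (rule integral_cong)
    fix x assume "x \<in> {-L..L}"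
    then have "\<bar>x\<bar> \<le> L" by auto
    then have eq: "u (?P x) = u x" "u' (?P x) = u' x" "u'' (?P x) = u'' x"
      using periodize_eq[where g = u, OF pos(2) r supp'(1)]
        periodize_eq[where g = u', OF pos(2) r supp'(2)]
        periodize_eq[where g = u'', OF pos(2) r supp'(3)] by auto
    then show "(u'' (?P x))\<^sup>2 - (u' (?P x))\<^sup>2 + ?V x * (u (?P x))\<^sup>2 = ?G (x * s)"
      unfolding eq by (simp add: u_def u'_def u''_def)
  qed
  also have "\<dots> = integral {-R..R} ?G / s"
    by (intro integral_unique has_integral_rescaled)
      (use pos supp in \<open>auto intro!: continuous_intros cw w q\<close>)
  finally have "0 \<le> integral {-R..R} ?G" using pos by (simp add: zero_le_divide_iff)
  also have "\<dots> \<le> integral {-R..R}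
      (\<lambda>x. s ^ 4 * (w'' x)\<^sup>2 + A * (w x)\<^sup>2 + B * (q x * (w x)\<^sup>2))"
  proof (rule integral_le)
    fix x
    have "(s\<^sup>2 * w'' x)\<^sup>2 = s ^ 4 * (w'' x)\<^sup>2" by (simp add: power_mult_distrib flip: power_mult)
    then show "?G x \<le> s ^ 4 * (w'' x)\<^sup>2 + A * (w x)\<^sup>2 + B * (q x * (w x)\<^sup>2)"
      by (simp add: algebra_simps)
  qed (intro integrable_continuous_real continuous_intros cw[THEN continuous_on_subset]
      w(3)[THEN continuous_on_subset] q[THEN continuous_on_subset]; simp)+
  also have "\<dots> = s ^ 4 * integral {-R..R} (\<lambda>x. (w'' x)\<^sup>2) + A * integral {-R..R} (\<lambda>x. (w x)\<^sup>2)
    + B * integral {-R..R} (\<lambda>x. q x * (w x)\<^sup>2)"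
  proof -
    have i: "(\<lambda>x. (w'' x)\<^sup>2) integrable_on {-R..R}" "(\<lambda>x. (w x)\<^sup>2) integrable_on {-R..R}"
      "(\<lambda>x. q x * (w x)\<^sup>2) integrable_on {-R..R}"
      by (intro integrable_continuous_real continuous_intros cw[THEN continuous_on_subset]
        w(3)[THEN continuous_on_subset] q[THEN continuous_on_subset]; simp)+
    show ?thesis
      using i[THEN integrable_integral]
      by (intro integral_unique has_integral_add has_integral_mult_right) auto
  qed
  finally show ?thesis .
qed
section \<open>A profile concentrated where the well is negative\<close>

text \<open>The profile is \<open>w(x) = x (max 0 (-q x))\<^sup>3\<close>. The positive part of \<open>-q\<close> restricts it to the
  set where \<open>q < 0\<close>, its cube is twice continuously differentiable, and the factor \<open>x\<close> enforces
  \<open>w 0 = 0\<close> without losing strict negativity, since a single point cannot carry the negative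
  integral of \<open>q\<close>.\<close>
lemma localized_profile:
  assumes q: "C2 q" "\<And>x. \<bar>x\<bar> \<ge> R \<Longrightarrow> q x = 0" and neg: "integral {-R..R} q < 0"
  shows "\<exists>w w' w'' :: real \<Rightarrow> real. (\<forall>x. (w has_real_derivative w' x) (at x)) \<and>
    (\<forall>x. (w' has_real_derivative w'' x) (at x)) \<and> continuous_on UNIV w'' \<and> w 0 = 0 \<and>
    (\<forall>x. \<bar>x\<bar> \<ge> R \<longrightarrow> w x = 0 \<and> w' x = 0 \<and> w'' x = 0) \<and>
    integral {-R..R} (\<lambda>x. q x * (w x)\<^sup>2) < 0"
proof -
  define q' q'' where "q' = deriv q" and "q'' = deriv (deriv q)"
  have d: "(q has_real_derivative q' x) (at x)" "(q' has_real_derivative q'' x) (at x)" for x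
    using C2_D(1,2)[OF q(1)] by (auto simp: q'_def q''_def)
  have c'': "continuous_on UNIV q''" using C2_D(3)[OF q(1)] by (simp add: q''_def)
  have c: "continuous_on UNIV q" and c': "continuous_on UNIV q'"
    using d by (meson DERIV_isCont continuous_at_imp_continuous_on)+
  define p where "p = (\<lambda>x. max 0 (- q x))"
  have cp: "continuous_on UNIV p" unfolding p_def by (intro continuous_intros c)
  have dp: "((\<lambda>x. p x ^ (n + 2)) has_real_derivative - (real (n + 2) * p x ^ (n + 1) * q' x)) (at x)" for n x
    using DERIV_chain2[OF DERIV_max_0_power DERIV_minus[OF d(1)], of n x] by (simp add: p_def)
  define w w' w'' where "w = (\<lambda>x. x * p x ^ 3)"
    and "w' = (\<lambda>x. p x ^ 3 - 3 * x * (p x ^ 2 * q' x))"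
    and "w'' = (\<lambda>x. - 6 * (p x)\<^sup>2 * q' x + 6 * x * p x * (q' x)\<^sup>2 - 3 * x * (p x)\<^sup>2 * q'' x)"
  have dp2: "((\<lambda>x. p x ^ 2) has_real_derivative - (2 * p x * q' x)) (at x)" for x
    using dp[of 0 x] by (simp add: power2_eq_square)
  have dp3: "((\<lambda>x. p x ^ 3) has_real_derivative - (3 * p x ^ 2 * q' x)) (at x)" for x
    using dp[of 1 x] by (simp add: numeral_eq_Suc)
  have cw: "continuous_on UNIV w" unfolding w_def by (intro continuous_intros cp)
  have sgn: "q x * (w x)\<^sup>2 \<le> 0" for x
    by (auto simp: w_def p_def max_def mult_le_0_iff)
  let ?J = "integral {-R..R} (\<lambda>x. q x * (w x)\<^sup>2)"
  have cJ: "continuous_on (cbox (-R) R) (\<lambda>x. - (q x * (w x)\<^sup>2))"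
    by (intro continuous_intros continuous_on_subset[OF c] continuous_on_subset[OF cw]) auto
  have J: "((\<lambda>x. - (q x * (w x)\<^sup>2)) has_integral - ?J) (cbox (-R) R)"
    using integrable_integral[OF integrable_continuous[OF cJ]] by simp
  have "?J < 0"
  proof (rule ccontr)
    assume "\<not> ?J < 0"
    moreover have "- ?J \<ge> 0" by (rule has_integral_nonneg[OF J]) (use sgn in auto)
    ultimately have J0: "((\<lambda>x. - (q x * (w x)\<^sup>2)) has_integral 0) (cbox (-R) R)" using J by simp
    have R: "R > 0"
    proof (rule ccontr)
      assume "\<not> R > 0"
      then have "{-R..R} = {} \<or> {-R..R} = {0}" by auto
      then show False using neg by auto
    qed
    have "q x \<ge> 0" if "x \<in> {-R..R} - {0}" for x
    proof -
      have "- (q x * (w x)\<^sup>2) = 0"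
        by (rule has_integral_0_cbox_imp_0[OF cJ _ J0]) (use sgn R that in auto)
      then show ?thesis using that by (auto simp: w_def p_def max_def split: if_splits)
    qed
    then have "integral {-R..R} q = integral {-R..R} (\<lambda>x. \<bar>q x\<bar>)"
      by (intro integral_spike[of "{0}"]) auto
    also have "\<dots> \<ge> 0"
      by (intro integral_nonneg integrable_continuous_real continuous_intros continuous_on_subset[OF c]) auto
    finally show False using neg by simp
  qed
  moreover have "(w has_real_derivative w' x) (at x)" for x
    unfolding w_def w'_def
    by (rule DERIV_cong[OF DERIV_mult[OF DERIV_ident dp3]]) (simp add: algebra_simps)
  moreover have "(w' has_real_derivative w'' x) (at x)" for x
    unfolding w'_def w''_def
    by (rule DERIV_cong[OF DERIV_diff[OF dp3 DERIV_mult[OF DERIV_cmult[OF DERIV_ident] DERIV_mult[OF dp2 d(2)]]]])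
      (simp add: algebra_simps power2_eq_square)
  moreover have "continuous_on UNIV w''"
    unfolding w''_def by (intro continuous_intros cp c' c'')
  moreover have "w 0 = 0" by (simp add: w_def)
  moreover have "p x = 0" if "\<bar>x\<bar> \<ge> R" for x using q(2)[OF that] by (simp add: p_def)
  ultimately show ?thesis
    by (intro exI[of _ w] exI[of _ w'] exI[of _ w'']) (simp add: w_def w'_def w''_def)
qed

section \<open>The mean of the potential and the norm of its derivative\<close>

lemma integral_deriv_squared_pos:
  assumes q: "C2 q" "\<And>x. \<bar>x\<bar> \<ge> R \<Longrightarrow> q x = 0" and ne: "integral {-R..R} q \<noteq> 0"
  shows "integral {-R..R} (\<lambda>x. (deriv q x)\<^sup>2) > 0"
proof (rule ccontr)
  have R: "R > 0"
  proof (rule ccontr)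
    assume "\<not> R > 0"
    then have "{-R..R} = {} \<or> {-R..R} = {0}" by auto
    then show False using ne by auto
  qed
  have c': "continuous_on UNIV (deriv q)"
    using C2_D(2)[OF q(1)] by (meson DERIV_isCont continuous_at_imp_continuous_on)
  have cJ: "continuous_on (cbox (-R) R) (\<lambda>x. (deriv q x)\<^sup>2)"
    by (intro continuous_intros continuous_on_subset[OF c']) auto
  have J: "((\<lambda>x. (deriv q x)\<^sup>2) has_integral integral {-R..R} (\<lambda>x. (deriv q x)\<^sup>2)) (cbox (-R) R)"
    using integrable_integral[OF integrable_continuous[OF cJ]] by simp
  assume "\<not> integral {-R..R} (\<lambda>x. (deriv q x)\<^sup>2) > 0"
  moreover have "integral {-R..R} (\<lambda>x. (deriv q x)\<^sup>2) \<ge> 0" by (rule has_integral_nonneg[OF J]) auto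
  ultimately have J0: "((\<lambda>x. (deriv q x)\<^sup>2) has_integral 0) (cbox (-R) R)" using J by simp
  have d0: "deriv q x = 0" if "x \<in> {-R..R}" for x
    using has_integral_0_cbox_imp_0[OF cJ _ J0, of x] R that by simp
  have "q x = 0" if "x \<in> {-R..R}" for x
  proof -
    have cq: "continuous_on {-R..R} q"
      using C2_D(1)[OF q(1)] by (meson DERIV_isCont continuous_at_imp_continuous_on)
    have "(q has_real_derivative 0) (at y)" if "-R < y" "y < R" for y
      using C2_D(1)[OF q(1), of y] d0[of y] that by simp
    then have "q x = q (-R)"
      using DERIV_isconst2[of "-R" R q x] cq R that by simp
    then show ?thesis using q(2)[of "-R"] by simp
  qed
  then have "integral {-R..R} q = integral {-R..R} (\<lambda>x. 0)" by (rule integral_cong)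
  then show False using ne by simp
qed

text \<open>The background integrates to \<open>2 \<gamma> L\<^bsup>c2-c1\<^esup>\<close> and the well to
  \<open>L\<^bsup>c2-c1\<^esup> \<integral> q\<close>: the exponent of the background is the one for which the powers of \<open>L\<close>
  cancel.\<close>
lemma vanishing_mean_imp_integral:
  fixes L R c1 c2 \<gamma> :: real
  assumes q: "continuous_on UNIV q" "\<And>x. \<bar>x\<bar> \<ge> R \<Longrightarrow> q x = 0" and L: "L > 0" "R \<le> L * L powr c1"
    and W: "\<And>x. x \<in> {-L<..<L} \<Longrightarrow> W x = \<gamma> * L powr (c2 - c1 - 1) + L powr c2 * q (x * L powr c1)"
    and mean: "(W has_integral 0) {-L..L}"
  shows "integral {-R..R} q = - 2 * \<gamma>"
proof -
  let ?A = "\<gamma> * L powr (c2 - c1 - 1)"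
  have "((\<lambda>x. ?A + L powr c2 * q (x * L powr c1)) has_integral 0) {-L..L}"
  proof (rule has_integral_spike_finite[OF _ _ mean, of "{-L, L}"])
    fix x assume "x \<in> {-L..L} - {-L, L}"
    then have "x \<in> {-L<..<L}" by auto
    then show "?A + L powr c2 * q (x * L powr c1) = W x" by (rule W[symmetric])
  qed simp
  moreover have "((\<lambda>x. ?A + L powr c2 * q (x * L powr c1)) has_integral
      ?A * (2 * L) + L powr c2 * (integral {-R..R} q / L powr c1)) {-L..L}"
    using has_integral_const_real[of ?A "-L" L] L
    by (intro has_integral_add has_integral_mult_right has_integral_rescaled[OF q])
      (auto simp: mult.commute)
  ultimately have "0 = ?A * (2 * L) + L powr c2 * (integral {-R..R} q / L powr c1)"
    by (rule has_integral_unique)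
  also have "\<dots> = L powr (c2 - c1) * (2 * \<gamma> + integral {-R..R} q)"
    using L by (simp add: powr_diff powr_add field_simps)
  finally show ?thesis using L by simp
qed

lemma L2_norm_second_deriv:
  assumes q: "C2 q" "\<And>x. \<bar>x\<bar> \<ge> R \<Longrightarrow> deriv q x = 0" and s: "s > 0" "R \<le> L * s" and B: "B \<ge> 0"
    and f: "\<And>x. x \<in> {-L<..<L} \<Longrightarrow> deriv f x = A + B * q (x * s)"
  shows "L2_norm L (deriv (deriv f)) = B * sqrt s * sqrt (integral {-R..R} (\<lambda>x. (deriv q x)\<^sup>2))"
proof -
  have c': "continuous_on UNIV (deriv q)"
    using C2_D(2)[OF q(1)] by (meson DERIV_isCont continuous_at_imp_continuous_on)
  have d: "deriv (deriv f) x = B * s * deriv q (x * s)" if "x \<in> {-L<..<L}" for x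
  proof (rule DERIV_imp_deriv)
    have ev: "\<forall>\<^sub>F y in nhds x. deriv f y = A + B * q (y * s)"
      using eventually_nhds_in_open[OF _ that] by (auto elim!: eventually_mono simp: f)
    have scale: "((\<lambda>x. x * s) has_real_derivative s) (at x)"
      by (auto intro!: derivative_eq_intros)
    have "((\<lambda>y. A + B * q (y * s)) has_real_derivative B * s * deriv q (x * s)) (at x)"
      by (rule DERIV_cong[OF DERIV_add[OF DERIV_const
          DERIV_cmult[OF DERIV_chain2[OF C2_D(1)[OF q(1)] scale]]]]) simp
    then show "(deriv f has_real_derivative B * s * deriv q (x * s)) (at x)"
      using DERIV_cong_ev[OF refl ev refl] by blast
  qed
  have "integral {-L..L} (\<lambda>x. (deriv (deriv f) x)\<^sup>2)
      = integral {-L..L} (\<lambda>x. (B * s)\<^sup>2 * (deriv q (x * s))\<^sup>2)"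
    by (rule integral_spike[of "{-L, L}"]) (auto simp: d power_mult_distrib)
  also have "\<dots> = (B * s)\<^sup>2 * (integral {-R..R} (\<lambda>x. (deriv q x)\<^sup>2) / s)"
    by (intro integral_unique has_integral_mult_right has_integral_rescaled[where g = "\<lambda>x. (deriv q x)\<^sup>2"])
      (use q s in \<open>auto intro!: continuous_intros c'\<close>)
  also have "\<dots> = B\<^sup>2 * s * integral {-R..R} (\<lambda>x. (deriv q x)\<^sup>2)"
    using s by (simp add: power2_eq_square)
  finally show ?thesis using B by (simp add: L2_norm_def real_sqrt_mult)
qed

lemma L2_norm_le_H2_norm: "L2_norm L (deriv (deriv f)) \<le> H2_norm L f"
  unfolding H2_norm_def by (rule real_le_rsqrt) simp

lemma compactly_supported_bound:
  assumes "compactly_supported q"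
  obtains R where "R > 0" "\<And>x. \<bar>x\<bar> \<ge> R \<Longrightarrow> q x = 0" "\<And>x. \<bar>x\<bar> \<ge> R \<Longrightarrow> deriv q x = 0"
proof -
  have "bounded (support_on UNIV q)"
    using assms unfolding compactly_supported_def
    by (meson bounded_subset closure_subset compact_imp_bounded)
  then obtain R where R: "\<forall>x\<in>support_on UNIV q. norm x \<le> R" unfolding bounded_iff by blast
  then have q0: "q x = 0" if "\<bar>x\<bar> > \<bar>R\<bar>" for x
    using that by (force simp: support_on_def)
  have "deriv q x = 0" if "\<bar>x\<bar> \<ge> \<bar>R\<bar> + 1" for x
  proof (rule DERIV_imp_deriv)
    have ev: "\<forall>\<^sub>F y in nhds x. q y = 0"
      unfolding eventually_nhds_metric
      using that by (intro exI[of _ 1]) (auto intro!: q0 simp: dist_real_def)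
    show "(q has_real_derivative 0) (at x)"
      using DERIV_cong_ev[OF refl ev refl] by simp
  qed
  then show thesis using that[of "\<bar>R\<bar> + 1"] q0 by simp
qed

section \<open>Constraints on the exponents\<close>

text \<open>If \<open>c2 < c1 + 1\<close>, all three terms in the bound from the lowest mode tend to zero. The one
  from the well is a multiple of \<open>L\<^bsup>c2-2-2c1\<^esup>\<close>, whose exponent is then less than
  \<open>-1 - c1\<close>.\<close>
lemma coercive_imp_exponent_ge:
  assumes co: "\<forall>\<^sub>F L in at_top. coercive_potential L
      (\<lambda>x. \<gamma> * L powr (c2 - c1 - 1) + L powr c2 * q (x * L powr c1)) \<delta>"
    and q: "continuous_on UNIV q" "\<And>x. \<bar>x\<bar> \<ge> R \<Longrightarrow> q x = 0" "\<And>x. \<bar>q x\<bar> \<le> M"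
    and pos: "\<gamma> \<ge> 0" "R > 0" "\<delta> > 0" "c1 > - 1"
  shows "c2 \<ge> c1 + 1"
proof (rule ccontr)
  assume "\<not> c2 \<ge> c1 + 1"
  then have c: "c2 < c1 + 1" by simp
  let ?E = "\<lambda>L. 2 * (pi ^ 4 * L powr (- 4) + \<gamma> * L powr (c2 - c1 - 1)
    + M * (pi * R)\<^sup>2 * L powr (c2 - 2 - 2 * c1))"
  have "\<forall>\<^sub>F L in at_top. \<delta> \<le> ?E L"
    using co eventually_gt_at_top[of 0]
  proof eventually_elim
    case (elim L)
    have mode: "(pi / L) ^ 4 = pi ^ 4 * L powr (- 4)"
      using elim by (simp add: power_divide powr_minus_divide)
    have well: "L powr c2 * (M * (pi / L * (R / L powr c1))\<^sup>2)
        = M * (pi * R)\<^sup>2 * L powr (c2 - 2 - 2 * c1)"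
    proof -
      have "L powr (c2 - 2 - 2 * c1) = L powr c2 / (L\<^sup>2 * (L powr c1)\<^sup>2)"
        using elim by (simp add: powr_diff powr_power mult.commute)
      then show ?thesis by (simp add: power_mult_distrib power_divide)
    qed
    have "\<delta> \<le> 2 * ((pi / L) ^ 4 + \<gamma> * L powr (c2 - c1 - 1)
        + L powr c2 * (M * (pi / L * (R / L powr c1))\<^sup>2))"
      by (rule coercive_lowest_mode[OF elim(1) q]) (use elim pos in auto)
    then show ?case unfolding mode well .
  qed
  moreover have "(?E \<longlongrightarrow> 2 * (pi ^ 4 * 0 + \<gamma> * 0 + M * (pi * R)\<^sup>2 * 0)) at_top"
    using c pos by (intro tendsto_intros tendsto_neg_powr filterlim_ident) auto
  ultimately have "\<delta> \<le> 2 * (pi ^ 4 * 0 + \<gamma> * 0 + M * (pi * R)\<^sup>2 * 0)"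
    by (intro tendsto_lowerbound[of ?E]) auto
  then show False using pos by simp
qed

text \<open>Dividing the inequality for the localized profile by \<open>L\<^bsup>c2\<^esup>\<close> leaves the bending term with
  the power \<open>4 c1 - c2\<close> and the background with \<open>-c1 - 1\<close>. If \<open>c2 > 4 c1\<close>, only the negative
  well term survives in the limit.\<close>
lemma coercive_imp_exponent_le:
  assumes co: "\<forall>\<^sub>F L in at_top. coercive_potential L
      (\<lambda>x. \<gamma> * L powr (c2 - c1 - 1) + L powr c2 * q (x * L powr c1)) \<delta>"
    and q: "C2 q" "\<And>x. \<bar>x\<bar> \<ge> R \<Longrightarrow> q x = 0" and neg: "integral {-R..R} q < 0"
    and R: "\<forall>\<^sub>F L in at_top. R < L * L powr c1"
    and pos: "\<delta> \<ge> 0" "c1 > - 1"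
  shows "c2 \<le> 4 * c1"
proof (rule ccontr)
  assume "\<not> c2 \<le> 4 * c1"
  then have c: "4 * c1 < c2" by simp
  have cq: "continuous_on UNIV q"
    using C2_D(1)[OF q(1)] by (meson DERIV_isCont continuous_at_imp_continuous_on)
  obtain w w' w'' where w: "\<And>x. (w has_real_derivative w' x) (at x)"
      "\<And>x. (w' has_real_derivative w'' x) (at x)" "continuous_on UNIV w''" "w 0 = 0"
    and supp: "\<And>x. \<bar>x\<bar> \<ge> R \<Longrightarrow> w x = 0" "\<And>x. \<bar>x\<bar> \<ge> R \<Longrightarrow> w' x = 0"
      "\<And>x. \<bar>x\<bar> \<ge> R \<Longrightarrow> w'' x = 0"
    and J: "integral {-R..R} (\<lambda>x. q x * (w x)\<^sup>2) < 0"
    using localized_profile[OF q neg] by blast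
  define I2 I0 J where "I2 = integral {-R..R} (\<lambda>x. (w'' x)\<^sup>2)"
    and "I0 = integral {-R..R} (\<lambda>x. (w x)\<^sup>2)" and "J = integral {-R..R} (\<lambda>x. q x * (w x)\<^sup>2)"
  let ?E = "\<lambda>L. L powr (4 * c1 - c2) * I2 + \<gamma> * L powr (- c1 - 1) * I0 + J"
  have "\<forall>\<^sub>F L in at_top. 0 \<le> ?E L"
    using co R eventually_gt_at_top[of 0]
  proof eventually_elim
    case (elim L)
    have "0 \<le> (L powr c1) ^ 4 * I2 + \<gamma> * L powr (c2 - c1 - 1) * I0 + L powr c2 * J"
      unfolding I2_def I0_def J_def
      using elim by (intro coercive_localized[OF elim(1) pos(1) cq w supp]) auto
    also have "\<dots> = L powr c2 * ?E L"
    proof -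
      have "(L powr c1) ^ 4 = L powr c2 * L powr (4 * c1 - c2)"
        using elim by (simp add: powr_power mult.commute flip: powr_add)
      moreover have "L powr (c2 - c1 - 1) = L powr c2 * L powr (- c1 - 1)"
        by (simp add: algebra_simps flip: powr_add)
      ultimately show ?thesis by (simp add: algebra_simps)
    qed
    finally show ?case using elim by (simp add: zero_le_mult_iff)
  qed
  moreover have "(?E \<longlongrightarrow> 0 * I2 + \<gamma> * 0 * I0 + J) at_top"
    using c pos by (intro tendsto_intros tendsto_neg_powr filterlim_ident) auto
  ultimately have "0 \<le> 0 * I2 + \<gamma> * 0 * I0 + J"
    by (intro tendsto_lowerbound[of ?E]) auto
  then show False using J by (simp add: J_def)
qed

theorem mainTheorem3:
  fixes \<gamma> c1 c2 \<delta> :: real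
    and q :: "real \<Rightarrow> real"
    and \<phi> :: "real \<Rightarrow> real \<Rightarrow> real"
  assumes "\<gamma> > 0" and "c1 > 0" and "c2 > 0"
    and "C2 q" and "compactly_supported q"
    and phi: "\<forall>\<^sub>F L in at_top.
      periodic_fun_simple (\<phi> L) (2 * L)
      \<and> (\<forall>x. \<phi> L differentiable (at x))
      \<and> (\<forall>x\<in>{-L<..<L}.
            deriv (\<phi> L) x = \<gamma> * L powr (c2 - c1 - 1) + L powr c2 * q (x * L powr c1))
      \<and> (deriv (\<phi> L) has_integral 0) {-L..L}"
    and "\<delta> > 0"
    and coercive: "\<forall>\<^sub>F L in at_top. \<forall>u :: real \<Rightarrow> real.
      C2 u \<and> periodic_fun_simple u (2 * L) \<and> u 0 = 0 \<longrightarrow>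
        integral {-L..L}
          (\<lambda>x. (deriv (deriv u) x)\<^sup>2 - (deriv u x)\<^sup>2 + deriv (\<phi> L) x * (u x)\<^sup>2)
        \<ge> \<delta> * integral {-L..L} (\<lambda>x. (u x)\<^sup>2)"
  shows "c2 \<ge> c1 + 1 \<and> c2 \<le> 4 * c1 \<and> c2 + c1 / 2 \<ge> 3 / 2
    \<and> (\<exists>c>0. \<forall>\<^sub>F L in at_top.
          H2_norm L (\<phi> L) \<ge> L2_norm L (deriv (deriv (\<phi> L)))
          \<and> L2_norm L (deriv (deriv (\<phi> L))) \<ge> c * L powr (3 / 2))"
proof -
  obtain R where R: "R > 0" and q0: "\<And>x. \<bar>x\<bar> \<ge> R \<Longrightarrow> q x = 0"
      and q'0: "\<And>x. \<bar>x\<bar> \<ge> R \<Longrightarrow> deriv q x = 0"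
    using compactly_supported_bound[OF \<open>compactly_supported q\<close>] by blast
  have cq: "continuous_on UNIV q"
    using C2_D(1)[OF \<open>C2 q\<close>] by (meson DERIV_isCont continuous_at_imp_continuous_on)
  obtain M where M: "\<And>x. \<bar>q x\<bar> \<le> M"
  proof -
    have "bounded (q ` {-R..R})"
      by (intro compact_imp_bounded compact_continuous_image continuous_on_subset[OF cq]) auto
    then obtain M where M: "\<forall>x\<in>{-R..R}. \<bar>q x\<bar> \<le> M" unfolding bounded_iff by auto
    then have "0 \<le> M" using R by (force dest: bspec[of _ _ 0])
    show thesis
    proof (rule that)
      show "\<bar>q x\<bar> \<le> M" for x
        using M q0[of x] \<open>0 \<le> M\<close> by (cases "x \<in> {-R..R}") auto
    qed
  qed
  have large: "\<forall>\<^sub>F L in at_top. R < L * L powr c1"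
    using eventually_gt_at_top[of "max 1 R"]
  proof eventually_elim
    case (elim L)
    then have "L powr c1 \<ge> 1" using \<open>c1 > 0\<close> by (simp add: ge_one_powr_ge_zero)
    then have "L * 1 \<le> L * L powr c1" using elim by (intro mult_left_mono) auto
    then show ?case using elim by linarith
  qed
  have co: "\<forall>\<^sub>F L in at_top. coercive_potential L
      (\<lambda>x. \<gamma> * L powr (c2 - c1 - 1) + L powr c2 * q (x * L powr c1)) \<delta>"
    using phi coercive
  proof eventually_elim
    case (elim L)
    show ?case by (rule coercive_potentialI[where W = "deriv (\<phi> L)"]) (use elim in auto)
  qed
  have mean: "integral {-R..R} q = - 2 * \<gamma>"
  proof -
    obtain L where L: "R < L * L powr c1" "0 < L" "(deriv (\<phi> L) has_integral 0) {-L..L}"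
      "\<And>x. x \<in> {-L<..<L} \<Longrightarrow>
        deriv (\<phi> L) x = \<gamma> * L powr (c2 - c1 - 1) + L powr c2 * q (x * L powr c1)"
      using eventually_happens'[OF trivial_limit_at_top_linorder
          eventually_conj[OF phi eventually_conj[OF large eventually_gt_at_top[of 0]]]] by blast
    show ?thesis
      by (rule vanishing_mean_imp_integral[OF cq q0 L(2) _ L(4) L(3)]) (use L(1) in auto)
  qed
  have lower: "c2 \<ge> c1 + 1"
    by (rule coercive_imp_exponent_ge[where R = R, OF co cq q0 M])
      (use \<open>\<gamma> > 0\<close> \<open>\<delta> > 0\<close> \<open>c1 > 0\<close> R in auto)
  have upper: "c2 \<le> 4 * c1"
    by (rule coercive_imp_exponent_le[OF co \<open>C2 q\<close> q0 _ large])
      (use \<open>\<gamma> > 0\<close> \<open>\<delta> > 0\<close> \<open>c1 > 0\<close> mean in auto)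
  have exponent: "c2 + c1 / 2 \<ge> 3 / 2" using lower upper by linarith
  define N where "N = integral {-R..R} (\<lambda>x. (deriv q x)\<^sup>2)"
  have N: "N > 0" unfolding N_def
    by (rule integral_deriv_squared_pos[OF \<open>C2 q\<close> q0]) (use mean \<open>\<gamma> > 0\<close> in auto)
  have "\<forall>\<^sub>F L in at_top. L2_norm L (deriv (deriv (\<phi> L))) \<ge> sqrt N * L powr (3 / 2)"
    using phi large eventually_ge_at_top[of 1]
  proof eventually_elim
    case (elim L)
    have "L2_norm L (deriv (deriv (\<phi> L))) = L powr c2 * sqrt (L powr c1) * sqrt N"
      unfolding N_def
      by (rule L2_norm_second_deriv[OF \<open>C2 q\<close> q'0, where A = "\<gamma> * L powr (c2 - c1 - 1)"])
        (use elim in auto)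
    also have "L powr c2 * sqrt (L powr c1) = L powr (c2 + c1 / 2)"
      using elim by (simp add: powr_half_sqrt[symmetric] powr_powr powr_add)
    finally have "L2_norm L (deriv (deriv (\<phi> L))) = L powr (c2 + c1 / 2) * sqrt N" .
    moreover have "L powr (3 / 2) \<le> L powr (c2 + c1 / 2)"
      using exponent elim by (intro powr_mono) auto
    ultimately show ?case using N by (simp add: mult.commute)
  qed
  then show ?thesis
    using lower upper exponent N L2_norm_le_H2_norm by (intro conjI exI[of _ "sqrt N"]) auto
qed

end
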